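(* For every $\alpha\in[-\infty,0)$ and every integer $n\ge1$, $$C(n,\alpha)\le\frac{1}{2^{\,n+1/\alpha}}\binom{2n}{n},$$ where $1/\alpha$ is understood as $0$ when $\alpha=-\infty$.
   Context: For $\alpha\in[-\infty,0)$, $a,b\in[0,\infty]$ and $t\in[0,1]$, the mean of order $\alpha$ is $M_\alpha(a,b;t)=\left(ta^\alpha+(1-t)b^\alpha\right)^{1/\alpha}$ if $\alpha\in(-\infty,0)$ and $a\ne0$, $b\neq 0$ (with the conventions $\infty^\alpha=0$ and $0^{1/\alpha}=\infty$; in particular $M_\alpha(\infty,c;\tfrac12)=M_\alpha(c,\infty;\tfrac12)=c/2^{1/\alpha}$ and $M_\alpha(\infty,\infty;t)=\infty$); $M_\alpha(a,b;t)=0$ if $\alpha\in(-\infty,0)$ and either $a=0$ or $b=0$; $M_{-\infty}(a,b;t)=\min\{a,b\}$. A function $f:\mathbf{R}^n\to[0,\infty]$ is $\alpha$-concave if $f(tx+(1-t)y)\ge M_\alpha(f(x),f(y);t)$ for all $x,y\in\mathbf{R}^n$ and all $t\in[0,1]$. The difference function of order $\alpha$ of $f:\mathbf{R}^n\to[0,\infty]$ is $$\Delta_\alpha f(z)=\sup\left\{M_\alpha\left(f(x),f(-y);\tfrac12\right)\;:\;x,y\in\mathbf{R}^n,\ \tfrac12(x+y)=z\right\},\quad z\in\mathbf{R}^n.$$ The constant is $$C(n,\alpha)=\sup\left\{\frac{\int_{\mathbf{R}^n}\Delta_\alpha f\,dz}{\int_{\mathbf{R}^n}f\,dx}\;:\;f:\mathbf{R}^n\to[0,\infty]\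 \text{is }\alpha\text{-concave},\ 0<\int_{\mathbf{R}^n}f\,dx<\infty\right\}.$$ *)

theory Defs
  imports "HOL-Analysis.Analysis"
begin

text \<open>Powers with a negative real exponent on \<open>[0, \<infinity>]\<close>, with the conventions
  \<open>0 ^ p = \<infinity>\<close> and \<open>\<infinity> ^ p = 0\<close>; only meant for \<open>p < 0\<close>.
  (The real function \<open>powr\<close> has \<open>0 powr p = 0\<close>, so it cannot be used at \<open>0\<close>.)\<close>

definition ennreal_neg_powr :: "ennreal \<Rightarrow> real \<Rightarrow> ennreal" where
  "ennreal_neg_powr a p =
     (if a = 0 then \<infinity> else if a = \<infinity> then 0 else ennreal (enn2real a powr p))"

text \<open>The mean \<open>M\<^sub>\<alpha>(a, b; t)\<close>; only meant for \<open>-\<infinity> \<le> \<alpha> < 0\<close> and \<open>0 \<le> t \<le> 1\<close>.\<close>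

definition alpha_mean :: "ereal \<Rightarrow> ennreal \<Rightarrow> ennreal \<Rightarrow> real \<Rightarrow> ennreal" where
  "alpha_mean \<alpha> a b t =
     (if \<alpha> = -\<infinity> then min a b
      else if a = 0 \<or> b = 0 then 0
      else ennreal_neg_powr
             (ennreal t * ennreal_neg_powr a (real_of_ereal \<alpha>)
               + ennreal (1 - t) * ennreal_neg_powr b (real_of_ereal \<alpha>))
             (1 / real_of_ereal \<alpha>))"

definition alpha_concave :: "ereal \<Rightarrow> (real ^ 'n \<Rightarrow> ennreal) \<Rightarrow> bool" where
  "alpha_concave \<alpha> f \<longleftrightarrow>
     (\<forall>x y. \<forall>t\<in>{0..1}. alpha_mean \<alpha> (f x) (f y) t \<le> f (t *\<^sub>R x + (1 - t) *\<^sub>R y))"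

definition difference_function ::
    "ereal \<Rightarrow> (real ^ 'n \<Rightarrow> ennreal) \<Rightarrow> real ^ 'n \<Rightarrow> ennreal" where
  "difference_function \<alpha> f z =
     Sup {alpha_mean \<alpha> (f x) (f (- y)) (1/2) | x y. (1/2) *\<^sub>R (x + y) = z}"

text \<open>The constant \<open>C(n, \<alpha>)\<close>, where \<open>n\<close> is the cardinality of the index type \<open>'n\<close>.
  For \<open>\<alpha> < 0\<close> the superlevel sets of an \<open>\<alpha>\<close>-concave function \<open>f\<close> and of its difference
  function are convex, hence Lebesgue (but not always Borel) measurable.  So both integrals
  are taken over \<open>lebesgue\<close>, and no measurability hypothesis on \<open>f\<close> is required.\<close>

definition difference_constant :: "'n::finite itself \<Rightarrow> ereal \<Rightarrow> ennreal" where
  "difference_constant _ \<alpha> =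
     Sup {(\<integral>\<^sup>+ z. difference_function \<alpha> f z \<partial>lebesgue) / (\<integral>\<^sup>+ x. f x \<partial>lebesgue) |
            f :: real ^ 'n \<Rightarrow> ennreal.
            alpha_concave \<alpha> f \<and>
            0 < (\<integral>\<^sup>+ x. f x \<partial>lebesgue) \<and> (\<integral>\<^sup>+ x. f x \<partial>lebesgue) < \<infinity>}"

end

theory Submission
  imports Defs
begin

text \<open>Since \<open>M\<^sub>\<alpha>(a, b; 1/2) \<le> 2 powr (-1/\<alpha>) * min a b\<close>, the difference function of order \<open>\<alpha>\<close>
  is at most \<open>2 powr (-1/\<alpha>)\<close> times the one of order \<open>-\<infinity>\<close>, whose superlevel sets are
  \<open>(K - K)/2\<close> for the superlevel sets \<open>K\<close> of \<open>f\<close>. These are convex, so the layer cake formula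
  reduces the bound to the Rogers-Shephard inequality \<open>|K - K| \<le> (2n choose n) |K|\<close>.
  The latter follows by integrating \<open>|K \<inter> (x + K)| \<ge> (1 - r)^n |K|\<close>, valid for
  \<open>x \<in> r(K - K)\<close> because \<open>x = r(a - b)\<close> with \<open>a, b \<in> K\<close> gives
  \<open>(1 - r)K + ra \<subseteq> K \<inter> (x + K)\<close>; the left-hand side integrates to \<open>|K|^2\<close>, and
  the right-hand side produces a beta integral.\<close>

section \<open>Two integrals of the weight n (1 - r)^(n - 1)\<close>

text \<open>The integral is n B(n + 1, n) = n * n! (n - 1)! / (2n)! = n! n! / (2n)!. The factor
  \<open>r ^ n\<close> will come from dilating a set by r in dimension n.\<close>

lemma nn_integral_beta_binomial:
  assumes "n \<ge> 1"
  shows "(\<integral>\<^sup>+ r. ennreal (real n * (1 - r) ^ (n - 1) * r ^ n) * indicator {0<..<1} r \<partial>lborel)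
           = ennreal (1 / real ((2 * n) choose n))"
proof -
  have beta: "((\<lambda>r. r ^ n * (1 - r) ^ (n - 1)) has_integral Beta (real n + 1) (real n)) {0<..<1}"
  proof -
    have "((\<lambda>t. t powr (real n + 1 - 1) * (1 - t) powr (real n - 1))
        has_integral Beta (real n + 1) (real n)) {0<..<1}"
      using has_integral_Beta_real[of "real n + 1" "real n"] assms
      by (simp add: has_integral_Icc_iff_Ioo)
    moreover have "t powr (real n + 1 - 1) * (1 - t) powr (real n - 1) = t ^ n * (1 - t) ^ (n - 1)"
      if "t \<in> {0<..<1}" for t :: real
      using that assms by (simp add: powr_realpow[symmetric] of_nat_diff)
    ultimately show ?thesis
      by (rule has_integral_eq[rotated])
  qed
  have "real n * Beta (real n + 1) (real n) = 1 / real ((2 * n) choose n)"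
  proof -
    obtain m where m: "n = Suc m" using assms by (cases n) auto
    have "Gamma (real n) = fact m" "Gamma (real n + 1) = fact n" "Gamma (real n + 1 + real n) = fact (2 * n)"
      using Gamma_fact[of m, where 'a=real] Gamma_fact[of n, where 'a=real] Gamma_fact[of "2*n", where 'a=real] m
      by (simp_all add: ac_simps)
    moreover have "real n * fact m = fact n" using m by simp
    moreover have "real ((2 * n) choose n) = fact (2 * n) / (fact n * fact n)"
      by (subst binomial_fact) (auto simp: mult_2)
    ultimately show ?thesis
      by (simp add: Beta_def field_simps flip: \<open>real n * fact m = fact n\<close>)
  qed
  then have "((\<lambda>r. real n * (1 - r) ^ (n - 1) * r ^ n) has_integral 1 / real ((2 * n) choose n)) {0<..<1}"
    using has_integral_mult_right[OF beta, of "real n"] by (simp add: ac_simps)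
  then show ?thesis
    by (intro nn_integral_has_integral_lebesgue') auto
qed

text \<open>The weight is minus the derivative of (1 - r)^n. Writing (1 - g)^n as an integral over r
  makes it accessible to Fubini when g depends on a point x.\<close>

lemma nn_integral_power_tail:
  assumes "n \<ge> 1" "0 \<le> g" "g \<le> (1::real)"
  shows "(\<integral>\<^sup>+ r. ennreal (real n * (1 - r) ^ (n - 1)) * indicator {g..1} r \<partial>lborel) = ennreal ((1 - g) ^ n)"
proof -
  have "((\<lambda>r. real n * (1 - r) ^ (n - 1)) has_integral (- ((1 - 1) ^ n) - (- ((1 - g) ^ n)))) {g..1}"
    by (rule fundamental_theorem_of_calculus)
      (use assms in \<open>auto intro!: derivative_eq_intros simp: has_real_derivative_iff_has_vector_derivative[symmetric]\<close>)
  then show ?thesis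
    using assms by (subst nn_integral_has_integral_lebesgue') (auto simp: zero_power)
qed

section \<open>The Rogers-Shephard inequality\<close>

lemma emeasure_lborel_affine:
  fixes S :: "'a::euclidean_space set"
  assumes "S \<in> sets borel" "(\<lambda>x. m *\<^sub>R x + d) ` S \<in> sets borel"
  shows "emeasure lborel ((\<lambda>x. m *\<^sub>R x + d) ` S) = ennreal (\<bar>m\<bar> ^ DIM('a)) * emeasure lborel S"
  using emeasure_lebesgue_affine[of m d S] assms by (simp add: ennreal_mult)

definition difference_body :: "'a::real_vector set \<Rightarrow> 'a set" where
  "difference_body K = {x - y | x y. x \<in> K \<and> y \<in> K}"

lemma emeasure_Int_translate_ge:
  fixes K :: "'a::euclidean_space set"
  assumes "open K" "convex K" "0 < r" "r < 1" "(1 / r) *\<^sub>R x \<in> difference_body K"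
  shows "ennreal ((1 - r) ^ DIM('a)) * emeasure lborel K \<le> emeasure lborel {y \<in> K. y - x \<in> K}"
proof -
  obtain a b where ab: "a \<in> K" "b \<in> K" "(1 / r) *\<^sub>R x = a - b"
    using assms(5) by (auto simp: difference_body_def)
  have "r *\<^sub>R ((1 / r) *\<^sub>R x) = r *\<^sub>R (a - b)" using ab(3) by simp
  then have x: "x = r *\<^sub>R a - r *\<^sub>R b" using assms(3) by (simp add: scaleR_diff_right)
  let ?S = "(\<lambda>y. (1 - r) *\<^sub>R y + r *\<^sub>R a) ` K"
  \<comment> \<open>As a translate of a dilate by the nonzero factor 1 - r, \<open>?S\<close> is
    open, hence Borel; the affine volume formula asks for this.\<close>
  have "?S = (\<lambda>y. r *\<^sub>R a + y) ` ((*\<^sub>R) (1 - r) ` K)"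
    by (auto simp: image_image add.commute)
  then have "open ?S"
    using assms by (simp only: open_translation open_scaling)
  have "?S \<subseteq> {y \<in> K. y - x \<in> K}"
  proof safe
    fix y assume "y \<in> K"
    then show "(1 - r) *\<^sub>R y + r *\<^sub>R a \<in> K"
      using assms ab by (intro convexD) auto
    have "(1 - r) *\<^sub>R y + r *\<^sub>R b \<in> K"
      using assms ab \<open>y \<in> K\<close> by (intro convexD) auto
    then show "(1 - r) *\<^sub>R y + r *\<^sub>R a - x \<in> K"
      by (simp add: x algebra_simps)
  qed
  moreover have "open {y \<in> K. y - x \<in> K}"
  proof -
    have "{y \<in> K. y - x \<in> K} = K \<inter> (\<lambda>y. y - x) -` K" by auto
    moreover have "open ((\<lambda>y. y - x) -` K)"
      by (intro open_vimage assms continuous_intros)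
    ultimately show ?thesis using assms by auto
  qed
  ultimately have "emeasure lborel ?S \<le> emeasure lborel {y \<in> K. y - x \<in> K}"
    by (intro emeasure_mono) auto
  then show ?thesis
    using emeasure_lborel_affine[of K "1 - r" "r *\<^sub>R a"] assms \<open>open ?S\<close> by (simp add: borel_open)
qed

text \<open>Fubini: for fixed y, the points x with y - x in K form the reflected translate y - K,
  which has the same volume as K.\<close>

lemma nn_integral_emeasure_Int_translate:
  fixes K :: "'a::euclidean_space set"
  assumes [measurable]: "K \<in> sets borel"
  shows "(\<integral>\<^sup>+ x. emeasure lborel {y \<in> K. y - x \<in> K} \<partial>lborel) = emeasure lborel K * emeasure lborel K"
proof -
  have "(\<integral>\<^sup>+ x. emeasure lborel {y \<in> K. y - x \<in> K} \<partial>lborel)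
      = (\<integral>\<^sup>+ x. \<integral>\<^sup>+ y. indicator K y * indicator K (y - x) \<partial>lborel \<partial>lborel)"
  proof (rule nn_integral_cong)
    fix x
    have "emeasure lborel {y \<in> K. y - x \<in> K} = (\<integral>\<^sup>+ y. indicator {y \<in> K. y - x \<in> K} y \<partial>lborel)"
      by simp
    also have "\<dots> = (\<integral>\<^sup>+ y. indicator K y * indicator K (y - x) \<partial>lborel)"
      by (intro nn_integral_cong) (auto simp: indicator_def)
    finally show "emeasure lborel {y \<in> K. y - x \<in> K} = \<dots>" .
  qed
  also have "\<dots> = (\<integral>\<^sup>+ y. \<integral>\<^sup>+ x. indicator K y * indicator K (y - x) \<partial>lborel \<partial>lborel)"
    by (rule lborel_pair.Fubini') measurable
  also have "\<dots> = (\<integral>\<^sup>+ y. indicator K y * emeasure lborel K \<partial>lborel)"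
  proof (rule nn_integral_cong)
    fix y
    have "(\<integral>\<^sup>+ x. indicator K (y - x) \<partial>lborel) = (\<integral>\<^sup>+ x. indicator K x \<partial>lborel)"
      by (subst (2) lborel_affine[of "-1" y]) (auto simp: density_1 nn_integral_distr simp del: nn_integral_indicator)
    then show "(\<integral>\<^sup>+ x. indicator K y * indicator K (y - x) \<partial>lborel) = indicator K y * emeasure lborel K"
      by (simp add: nn_integral_cmult)
  qed
  also have "\<dots> = emeasure lborel K * emeasure lborel K"
    by (simp add: nn_integral_multc)
  finally show ?thesis .
qed

lemma open_difference_body:
  fixes K :: "'a::real_normed_vector set"
  assumes "open K"
  shows "open (difference_body K)"
proof -
  have "difference_body K = (\<Union>y\<in>K. (\<lambda>x. - y + x) ` K)"
    by (force simp: difference_body_def)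
  also have "open \<dots>"
    using assms by (intro open_UN ballI open_translation)
  finally show ?thesis .
qed

lemma convex_difference_body:
  assumes "convex K"
  shows "convex (difference_body K)"
proof -
  have "difference_body K = (\<Union>x\<in>K. \<Union>y\<in>K. {x - y})"
    by (auto simp: difference_body_def)
  then show ?thesis using convex_differences[OF assms assms] by simp
qed

text \<open>Let g be the infimum of the admissible r, a gauge of x with respect to K - K. The
  estimate (1 - r)^n |K| at admissible r extends to r = g by a limit, and the weight over the
  admissible r, all of which lie in [g, 1], integrates to at most (1 - g)^n.\<close>

lemma rogers_shephard_pointwise:
  fixes K :: "'a::euclidean_space set"
  assumes "open K" "convex K" "emeasure lborel K \<noteq> \<infinity>"
  shows "emeasure lborel K * (\<integral>\<^sup>+ r. ennreal (real DIM('a) * (1 - r) ^ (DIM('a) - 1)) *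
            indicator {r \<in> {0<..<1}. (1 / r) *\<^sub>R x \<in> difference_body K} r \<partial>lborel)
         \<le> emeasure lborel {y \<in> K. y - x \<in> K}"
    (is "?V * (\<integral>\<^sup>+ r. _ * indicator ?R r \<partial>lborel) \<le> ?\<phi>")
proof (cases "?R = {}")
  case False
  define g where "g = Inf ?R"
  have bdd: "bdd_below ?R" by (rule bdd_belowI[of _ 0]) auto
  have R_ge: "g \<le> r" if "r \<in> ?R" for r
    unfolding g_def by (rule cInf_lower[OF that bdd])
  obtain r0 where "r0 \<in> ?R" using False by blast
  then have g1: "g \<le> 1" using R_ge[of r0] by auto
  have g0: "0 \<le> g" unfolding g_def using False by (intro cInf_greatest) auto
  have "g \<in> closure ?R" unfolding g_def
    by (rule closure_contains_Inf[OF False bdd])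
  \<comment> \<open>The infimum need not be attained, so it is approached by admissible
    values.\<close>
  then obtain s where s: "\<And>k. s k \<in> ?R" "s \<longlonglongrightarrow> g"
    unfolding closure_sequential by blast
  have "ennreal ((1 - g) ^ DIM('a)) * ?V \<le> ?\<phi>"
  proof (rule LIMSEQ_le_const2)
    have "(\<lambda>k. ennreal ((1 - s k) ^ DIM('a))) \<longlonglongrightarrow> ennreal ((1 - g) ^ DIM('a))"
      by (intro tendsto_ennrealI tendsto_intros s)
    \<comment> \<open>Finiteness of \<open>?V\<close> enters here: multiplication by infinity is not
      continuous at 0.\<close>
    then show "(\<lambda>k. ennreal ((1 - s k) ^ DIM('a)) * ?V) \<longlonglongrightarrow> ennreal ((1 - g) ^ DIM('a)) * ?V"
      using assms(3) ennreal_tendsto_cmult[of ?V] by (simp add: mult.commute[of _ ?V] top.not_eq_extremum)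
    show "\<exists>N. \<forall>k\<ge>N. ennreal ((1 - s k) ^ DIM('a)) * ?V \<le> ?\<phi>"
    proof (intro exI allI impI)
      fix k
      show "ennreal ((1 - s k) ^ DIM('a)) * ?V \<le> ?\<phi>"
        using s(1)[of k] by (intro emeasure_Int_translate_ge[OF assms(1,2)]) simp_all
    qed
  qed
  moreover have "(\<integral>\<^sup>+ r. ennreal (real DIM('a) * (1 - r) ^ (DIM('a) - 1)) * indicator ?R r \<partial>lborel)
      \<le> (\<integral>\<^sup>+ r. ennreal (real DIM('a) * (1 - r) ^ (DIM('a) - 1)) * indicator {g..1} r \<partial>lborel)"
    using R_ge by (intro nn_integral_mono) (auto simp: indicator_def)
  moreover have "\<dots> = ennreal ((1 - g) ^ DIM('a))"
    using g0 g1 by (intro nn_integral_power_tail) auto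
  ultimately show ?thesis
    by (metis (no_types, lifting) dual_order.trans mult.commute mult_left_mono zero_le)
next
  case True
  show ?thesis unfolding True by simp
qed

text \<open>The pointwise bound is integrated over x. Its right-hand side gives |K|^2. On the left,
  exchanging the integrals leaves, for each r, the volume r^n |K - K| of the dilate r(K - K), and
  then the beta integral in r. One factor |K| cancels.\<close>

lemma rogers_shephard_open:
  fixes K :: "'a::euclidean_space set"
  assumes "open K" "convex K"
  shows "emeasure lborel (difference_body K)
           \<le> ennreal (real ((2 * DIM('a)) choose DIM('a))) * emeasure lborel K"
proof -
  let ?n = "DIM('a)" and ?D = "difference_body K"
  let ?V = "emeasure lborel K" and ?W = "emeasure lborel ?D"
  let ?R = "\<lambda>x. {r \<in> {0<..<1}. (1 / r) *\<^sub>R x \<in> ?D}"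
  let ?w = "\<lambda>r::real. ennreal (real ?n * (1 - r) ^ (?n - 1))"
  let ?C = "real ((2 * ?n) choose ?n)"
  have C: "?C > 0" by simp
  have [measurable]: "K \<in> sets borel" "?D \<in> sets borel"
    by (simp_all add: assms(1) open_difference_body borel_open)
  have w: "(\<lambda>(x, r). ?w r * indicator (?R x) r) \<in> borel_measurable (lborel \<Otimes>\<^sub>M lborel)"
  proof -
    have "(\<lambda>p. ?w (snd p) * (indicator {0<..<1} (snd p) * indicator ?D ((1 / snd p) *\<^sub>R fst p)))
        \<in> borel_measurable (lborel \<Otimes>\<^sub>M lborel)"
      by measurable
    then show ?thesis
      by (rule measurable_cong[THEN iffD1, rotated]) (auto simp: indicator_def)
  qed
  show ?thesis
  \<comment> \<open>Cancelling \<open>?V\<close> requires 0 < \<open>?V\<close> < infinity. An open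
    set of volume 0 is empty, and for infinite volume the right-hand side is infinite.\<close>
  proof (cases "?V = 0 \<or> ?V = \<infinity>")
    case True
    then show ?thesis
    proof
      assume "?V = 0"
      then have "K = {}"
        using open_not_negligible[OF assms(1)] assms(1)
        by (auto simp: negligible_iff_emeasure0 borel_open)
      then show ?thesis by (simp add: difference_body_def)
    next
      assume "?V = \<infinity>"
      then show ?thesis by (simp add: ennreal_mult_top)
    qed
  next
    case False
    then have fin: "?V \<noteq> \<infinity>" by simp
    have "?V * (?W * ennreal (1 / ?C)) = ?V * (\<integral>\<^sup>+ r. \<integral>\<^sup>+ x. ?w r * indicator (?R x) r \<partial>lborel \<partial>lborel)"
    proof -
      have "(\<integral>\<^sup>+ x. ?w r * indicator (?R x) r \<partial>lborel) = ?W * (ennreal (real ?n * (1 - r) ^ (?n - 1) * r ^ ?n) * indicator {0<..<1} r)" for r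
      proof (cases "r \<in> {0<..<1}")
        case True
        \<comment> \<open>For fixed r in (0, 1), the condition on x describes the dilate r
          \<open>?D\<close>; the summand 0 only fits the shape of the affine volume formula.\<close>
        have "(\<integral>\<^sup>+ x. ?w r * indicator (?R x) r \<partial>lborel) = (\<integral>\<^sup>+ x. ?w r * indicator ((\<lambda>x. r *\<^sub>R x + 0) ` ?D) x \<partial>lborel)"
          using True
          by (intro nn_integral_cong arg_cong[where f="(*) _"]) (force simp: indicator_def image_iff split: if_splits)
        also have "open ((\<lambda>x. r *\<^sub>R x + 0) ` ?D)"
          using True open_scaling[OF _ open_difference_body[OF assms(1)], of r] by auto
        then have "(\<integral>\<^sup>+ x. ?w r * indicator ((\<lambda>x. r *\<^sub>R x + 0) ` ?D) x \<partial>lborel) = ?w r * (ennreal (\<bar>r\<bar> ^ ?n) * ?W)"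
          by (subst nn_integral_cmult_indicator) (simp, subst emeasure_lborel_affine, auto)
        finally show ?thesis using True by (simp add: ennreal_mult' ac_simps ennreal_mult)
      next
        case False
        then have "indicator (?R x) r = (0::ennreal)" for x
          by (auto simp: indicator_def)
        with False show ?thesis by simp
      qed
      then have "(\<integral>\<^sup>+ r. \<integral>\<^sup>+ x. ?w r * indicator (?R x) r \<partial>lborel \<partial>lborel)
          = ?W * (\<integral>\<^sup>+ r. ennreal (real ?n * (1 - r) ^ (?n - 1) * r ^ ?n) * indicator {0<..<1} r \<partial>lborel)"
        by (simp only:) (rule nn_integral_cmult, measurable)
      also have "\<dots> = ?W * ennreal (1 / ?C)"
        by (subst nn_integral_beta_binomial) (auto simp: Suc_leI)
      finally show ?thesis by simp
    qed
    also have "\<dots> = ?V * (\<integral>\<^sup>+ x. \<integral>\<^sup>+ r. ?w r * indicator (?R x) r \<partial>lborel \<partial>lborel)"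
      by (subst lborel_pair.Fubini'[OF w]) simp
    also have "\<dots> = (\<integral>\<^sup>+ x. ?V * (\<integral>\<^sup>+ r. ?w r * indicator (?R x) r \<partial>lborel) \<partial>lborel)"
      using lborel.borel_measurable_nn_integral_fst[OF w] by (intro nn_integral_cmult[symmetric]) simp
    also have "\<dots> \<le> (\<integral>\<^sup>+ x. emeasure lborel {y \<in> K. y - x \<in> K} \<partial>lborel)"
      by (intro nn_integral_mono rogers_shephard_pointwise assms fin)
    also have "\<dots> = ?V * ?V"
      by (rule nn_integral_emeasure_Int_translate) simp
    finally have *: "?V * (?W * ennreal (1 / ?C)) \<le> ?V * ?V" .
    with False have "?W * ennreal (1 / ?C) \<le> ?V"
      using * by (simp add: ennreal_mult_le_mult_iff)
    then have "ennreal ?C * (?W * ennreal (1 / ?C)) \<le> ennreal ?C * ?V"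
      by (rule mult_left_mono) simp
    moreover have "ennreal ?C * ennreal (1 / ?C) = 1"
      using C by (subst ennreal_mult[symmetric]) simp_all
    ultimately show ?thesis by (simp add: mult.left_commute[of _ ?W])
  qed
qed

text \<open>A convex set is its open interior together with part of its frontier, and the frontier
  of a convex set is negligible.\<close>

lemma sets_lebesgue_convex:
  fixes S :: "'a::euclidean_space set"
  assumes "convex S"
  shows "S \<in> sets lebesgue"
proof -
  have "negligible (S - interior S)"
    using closure_subset
    by (intro negligible_subset[OF negligible_convex_frontier[OF assms]]) (auto simp: frontier_def)
  then have "interior S \<union> (S - interior S) \<in> sets lebesgue"
    by (intro sets.Un) (auto intro: negligible_imp_sets)
  then show ?thesis
    using interior_subset[of S] by (simp add: Un_absorb1)
qed

text \<open>Extends the open case to all convex sets, since superlevel sets may be neither open nor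
  Borel.\<close>

theorem rogers_shephard:
  fixes K :: "'a::euclidean_space set"
  assumes "convex K"
  shows "emeasure lebesgue (difference_body K)
           \<le> ennreal (real ((2 * DIM('a)) choose DIM('a))) * emeasure lebesgue K"
proof (cases "interior K = {}")
  case True
  \<comment> \<open>A convex set without interior lies in a hyperplane, so its differences lie in
    the parallel hyperplane through 0, a null set.\<close>
  then obtain a b where ab: "a \<noteq> 0" "K \<subseteq> {x. a \<bullet> x = b}"
    using empty_interior_subset_hyperplane[OF assms] by metis
  then have "difference_body K \<subseteq> {x. a \<bullet> x = 0}"
    by (auto simp: difference_body_def inner_diff_right dest!: subsetD[OF ab(2)])
  then have "negligible (difference_body K)"
    using negligible_hyperplane[of a 0] ab negligible_subset by blast
  then have "emeasure lebesgue (difference_body K) = 0"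
    by (simp add: negligible_iff_null_sets null_setsD1)
  then show ?thesis by simp
next
  case False
  let ?I = "interior K"
  let ?E = "difference_body ?I"
  have I: "open ?I" "convex ?I" using assms by (auto intro: convex_interior)
  \<comment> \<open>By continuity of subtraction, K - K lies in the closure of I - I for the
    interior I; passing to that closure adds only the null frontier of a convex set.\<close>
  have "(\<lambda>(x, y). x - y) ` closure (?I \<times> ?I) \<subseteq> closure ?E"
  proof (rule image_closure_subset)
    show "continuous_on (closure (?I \<times> ?I)) (\<lambda>(x, y). x - y)"
      unfolding case_prod_unfold by (intro continuous_intros)
    have "(\<lambda>(x, y). x - y) ` (?I \<times> ?I) \<subseteq> ?E"
      by (auto simp: difference_body_def)
    then show "(\<lambda>(x, y). x - y) ` (?I \<times> ?I) \<subseteq> closure ?E"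
      using closure_subset by blast
  qed simp
  moreover have "K \<subseteq> closure ?I"
    using convex_closure_interior[OF assms False] closure_subset by auto
  ultimately have "difference_body K \<subseteq> closure ?E"
    by (auto simp: difference_body_def closure_Times)
  also have "\<dots> \<subseteq> ?E \<union> frontier ?E"
    using interior_subset[of ?E] by (auto simp: frontier_def)
  finally have sub: "difference_body K \<subseteq> ?E \<union> frontier ?E" .
  have E: "?E \<in> sets borel"
    using open_difference_body[OF I(1)] by (rule borel_open)
  have "frontier ?E \<in> null_sets lebesgue"
    using negligible_convex_frontier[OF convex_difference_body[OF I(2)]] by (simp add: negligible_iff_null_sets)
  then have "emeasure lebesgue (?E \<union> frontier ?E) = emeasure lebesgue ?E"
    using E by (intro emeasure_Un_null_set) auto
  then have "emeasure lebesgue (difference_body K) \<le> emeasure lborel ?E"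
    using emeasure_mono[OF sub, of lebesgue] E \<open>frontier ?E \<in> null_sets lebesgue\<close> by auto
  also have "\<dots> \<le> ennreal (real ((2 * DIM('a)) choose DIM('a))) * emeasure lborel ?I"
    by (rule rogers_shephard_open[OF I])
  also have "emeasure lborel ?I \<le> emeasure lebesgue K"
    using emeasure_mono[OF interior_subset[of K], of lebesgue] sets_lebesgue_convex[OF assms] by simp
  finally show ?thesis by (simp add: mult_left_mono)
qed

section \<open>The layer cake formula\<close>

text \<open>The same countable cover works for the completion. This makes Fubini available over
  \<open>lebesgue\<close>, the completion of \<open>lborel\<close>.\<close>

lemma sigma_finite_completion:
  assumes "sigma_finite_measure M"
  shows "sigma_finite_measure (completion M)"
proof -
  obtain A where "countable A" "A \<subseteq> sets M" "\<Union>A = space M" "\<forall>a\<in>A. emeasure M a \<noteq> \<infinity>"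
    using sigma_finite_measure.sigma_finite_countable[OF assms] by auto
  then show ?thesis
    by (intro sigma_finite_measure.intro exI[of _ A]) (auto simp: emeasure_completion subset_iff)
qed

lemma emeasure_lborel_less_ennreal: "emeasure lborel {t. 0 \<le> t \<and> ennreal t < c} = c"
proof (cases c)
  case (real r)
  then have "{t. 0 \<le> t \<and> ennreal t < c} = {0..<r}"
    by (auto simp: ennreal_less_iff)
  then show ?thesis using real by simp
next
  case top
  then have eq: "{t. 0 \<le> t \<and> ennreal t < c} = {0..}"
    by auto
  have "ennreal r \<le> emeasure lborel {0::real..}" if "0 \<le> r" for r
    using emeasure_mono[of "{0..r}" "{0::real..}" lborel] that by auto
  then have "emeasure lborel {0::real..} = \<infinity>"
  proof (cases "emeasure lborel {0::real..}")
    case (real r)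
    then show ?thesis
      using \<open>\<And>r. 0 \<le> r \<Longrightarrow> ennreal r \<le> emeasure lborel {0::real..}\<close>[of "r + 1"] by simp
  qed simp
  then show ?thesis using eq top by simp
qed

text \<open>Fubini for the region below the graph of f, whose fibre over x has length
  \<open>f x\<close>. The indicator of \<open>{0..}\<close> matters because \<open>ennreal t\<close>
  is 0 for negative t.\<close>

lemma (in sigma_finite_measure) nn_integral_layer_cake:
  assumes [measurable]: "f \<in> borel_measurable M"
  shows "(\<integral>\<^sup>+ x. f x \<partial>M) = (\<integral>\<^sup>+ t. indicator {0..} t * emeasure M {x \<in> space M. ennreal t < f x} \<partial>lborel)"
proof -
  interpret pair_sigma_finite M lborel ..
  let ?h = "\<lambda>x t. indicator {0..} t * indicator {x \<in> space M. ennreal t < f x} x :: ennreal"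
  have "(\<lambda>p. indicator {0..} (snd p) * indicator {p \<in> space (M \<Otimes>\<^sub>M lborel). ennreal (snd p) < f (fst p)} p :: ennreal)
      \<in> borel_measurable (M \<Otimes>\<^sub>M lborel)"
    by measurable
  then have h: "case_prod ?h \<in> borel_measurable (M \<Otimes>\<^sub>M lborel)"
    by (rule measurable_cong[THEN iffD1, rotated]) (auto simp: indicator_def space_pair_measure)
  have "(\<integral>\<^sup>+ x. f x \<partial>M) = (\<integral>\<^sup>+ x. \<integral>\<^sup>+ t. ?h x t \<partial>lborel \<partial>M)"
  proof (rule nn_integral_cong)
    fix x assume x: "x \<in> space M"
    have "f x = (\<integral>\<^sup>+ t. indicator {t. 0 \<le> t \<and> ennreal t < f x} t \<partial>lborel)"
      by (simp add: emeasure_lborel_less_ennreal)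
    also have "\<dots> = (\<integral>\<^sup>+ t. ?h x t \<partial>lborel)"
      using x by (intro nn_integral_cong) (auto simp: indicator_def)
    finally show "f x = \<dots>" .
  qed
  also have "\<dots> = (\<integral>\<^sup>+ t. \<integral>\<^sup>+ x. ?h x t \<partial>M \<partial>lborel)"
    by (rule Fubini'[OF h, symmetric])
  also have "\<dots> = (\<integral>\<^sup>+ t. indicator {0..} t * emeasure M {x \<in> space M. ennreal t < f x} \<partial>lborel)"
    by (intro nn_integral_cong) (simp add: nn_integral_cmult_indicator)
  finally show ?thesis .
qed

section \<open>Means of negative order compared with the minimum\<close>

lemma ennreal_neg_powr_antimono:
  assumes "p < 0" "a \<le> b"
  shows "ennreal_neg_powr b p \<le> ennreal_neg_powr a p"
proof (cases "a = 0 \<or> b = \<infinity>")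
  case False
  with assms(2) obtain r s where rs: "a = ennreal r" "b = ennreal s" "0 < r" "r \<le> s"
    by (cases a; cases b) (auto simp: top_unique)
  then have "s powr p \<le> r powr p"
    using assms(1) by (intro powr_mono2') auto
  then show ?thesis
    using rs by (simp add: ennreal_neg_powr_def ennreal_leI)
qed (use assms in \<open>auto simp: ennreal_neg_powr_def\<close>)

text \<open>The exponents p and 1/p undo each other, also at 0 and infinity. The case s = 1
  evaluates a mean of equal arguments; s = 1/2 produces the constant 2^(-1/p).\<close>

lemma ennreal_neg_powr_scale_inverse:
  assumes "p < 0" "0 < s"
  shows "ennreal_neg_powr (ennreal s * ennreal_neg_powr a p) (1 / p) = ennreal (s powr (1 / p)) * a"
proof (cases a)
  case (real r)
  show ?thesis
  proof (cases "r = 0")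
    case True
    then show ?thesis using real assms by (simp add: ennreal_neg_powr_def ennreal_mult_top)
  next
    case False
    then have r: "r > 0" using real by simp
    then show ?thesis
      using real assms by (simp add: ennreal_neg_powr_def powr_mult powr_powr flip: ennreal_mult)
  qed
qed (use assms in \<open>simp add: ennreal_neg_powr_def ennreal_mult_top\<close>)

text \<open>Replacing both arguments by their minimum increases the negative powers, hence lowers
  the mean, which then equals that minimum. Consequently \<alpha>-concave functions are
  quasiconcave.\<close>

lemma alpha_mean_ge_min:
  assumes "\<alpha> < 0" "0 \<le> t" "t \<le> 1"
  shows "min a b \<le> alpha_mean \<alpha> a b t"
proof (cases "\<alpha> = -\<infinity> \<or> a = 0 \<or> b = 0")
  case False
  with assms(1) obtain p where p: "\<alpha> = ereal p" "p < 0" by (cases \<alpha>) auto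
  let ?m = "min a b"
  have "ennreal t * ennreal_neg_powr a p + ennreal (1 - t) * ennreal_neg_powr b p
      \<le> ennreal t * ennreal_neg_powr ?m p + ennreal (1 - t) * ennreal_neg_powr ?m p"
    using p by (intro add_mono mult_left_mono ennreal_neg_powr_antimono) auto
  also have "\<dots> = ennreal 1 * ennreal_neg_powr ?m p"
    using assms by (simp flip: distrib_right ennreal_plus)
  finally have "ennreal_neg_powr (ennreal 1 * ennreal_neg_powr ?m p) (1 / p) \<le> alpha_mean \<alpha> a b t"
    using p False by (auto simp: alpha_mean_def intro!: ennreal_neg_powr_antimono)
  then show ?thesis
    using ennreal_neg_powr_scale_inverse[OF p(2), of 1 ?m] by simp
qed (auto simp: alpha_mean_def)

text \<open>Dropping the term of the larger argument shrinks the sum, and the negative outer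
  exponent turns this into an upper bound. At order -\<infinity> the factor is (1/2)^0 = 1.\<close>

lemma alpha_mean_half_le:
  assumes "\<alpha> < 0"
  shows "alpha_mean \<alpha> a b (1/2) \<le> ennreal ((1/2) powr real_of_ereal (1 / \<alpha>)) * min a b"
proof (cases \<alpha>)
  case (real p)
  with assms have p: "p < 0" by simp
  let ?m = "min a b"
  show ?thesis
  proof (cases "a = 0 \<or> b = 0")
    case False
    have "ennreal (1/2) * ennreal_neg_powr ?m p
        \<le> ennreal (1/2) * ennreal_neg_powr a p + ennreal (1 - 1/2) * ennreal_neg_powr b p"
      by (cases "a \<le> b") (simp_all add: min_def)
    then have "alpha_mean \<alpha> a b (1/2) \<le> ennreal_neg_powr (ennreal (1/2) * ennreal_neg_powr ?m p) (1 / p)"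
      using p False real by (simp add: alpha_mean_def ennreal_neg_powr_antimono)
    also have "\<dots> = ennreal ((1/2) powr (1 / p)) * ?m"
      using p by (intro ennreal_neg_powr_scale_inverse) auto
    finally show ?thesis using real p by (simp add: divide_ereal_def inverse_eq_divide)
  qed (use real in \<open>auto simp: alpha_mean_def\<close>)
qed (use assms in \<open>auto simp: alpha_mean_def divide_ereal_def\<close>)

section \<open>Difference functions and their superlevel sets\<close>

text \<open>With strict inequality the supremum need not be attained: it exceeds c exactly when some
  competitor does. The sign in \<open>f (- y)\<close> turns the midpoint of x and y into half a
  difference.\<close>

lemma superlevel_difference_function:
  "{z. c < difference_function (-\<infinity>) f z} = (\<lambda>x. (1/2) *\<^sub>R x + 0) ` difference_body {x. c < f x}"
proof safe
  fix z assume "c < difference_function (-\<infinity>) f z"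
  then obtain x y where xy: "(1/2) *\<^sub>R (x + y) = z" "c < min (f x) (f (- y))"
    unfolding difference_function_def less_Sup_iff by (auto simp: alpha_mean_def)
  then have "x - - y \<in> difference_body {x. c < f x}"
    unfolding difference_body_def by fastforce
  then show "z \<in> (\<lambda>x. (1/2) *\<^sub>R x + 0) ` difference_body {x. c < f x}"
    using xy(1) by auto
next
  fix z assume "z \<in> difference_body {x. c < f x}"
  then obtain x y where "c < f x" "c < f y" "z = x - y"
    by (auto simp: difference_body_def)
  then show "c < difference_function (-\<infinity>) f ((1/2) *\<^sub>R z + 0)"
    unfolding difference_function_def less_Sup_iff
    by (intro bexI[of _ "min (f x) (f y)"] CollectI exI[of _ x] exI[of _ "- y"]) (auto simp: alpha_mean_def)
qed

lemma convex_superlevel: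
  assumes "\<alpha> < 0" "alpha_concave \<alpha> f"
  shows "convex {x. c < f x}"
  unfolding convex_alt
proof safe
  fix x y and u :: real assume *: "c < f x" "c < f y" "0 \<le> u" "u \<le> 1"
  then have "c < min (f y) (f x)" by simp
  also have "\<dots> \<le> alpha_mean \<alpha> (f y) (f x) u"
    using * assms by (intro alpha_mean_ge_min)
  also have "\<dots> \<le> f (u *\<^sub>R y + (1 - u) *\<^sub>R x)"
    using * assms(2) by (auto simp: alpha_concave_def)
  finally show "c < f ((1 - u) *\<^sub>R x + u *\<^sub>R y)"
    by (simp add: add.commute)
qed

lemma borel_measurable_lebesgue_quasiconcave:
  fixes f :: "'a::euclidean_space \<Rightarrow> ennreal"
  assumes "\<And>c. convex {x. c < f x}"
  shows "f \<in> borel_measurable lebesgue"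
  using sets_lebesgue_convex[OF assms] by (intro borel_measurableI_greater) simp

lemma borel_measurable_difference_function_minfty:
  fixes f :: "real ^ 'n \<Rightarrow> ennreal"
  assumes "\<And>c. convex {x. c < f x}"
  shows "difference_function (-\<infinity>) f \<in> borel_measurable lebesgue"
proof (rule borel_measurable_lebesgue_quasiconcave)
  fix c
  have "convex ((*\<^sub>R) (1/2) ` difference_body {x. c < f x})"
    by (intro convex_scaling convex_difference_body assms)
  then show "convex {z. c < difference_function (-\<infinity>) f z}"
    by (simp add: superlevel_difference_function)
qed

text \<open>Rogers-Shephard is applied at each level and integrated over the levels; halving K - K
  contributes (1/2)^n.\<close>

lemma nn_integral_difference_function_minfty:
  fixes f :: "real ^ 'n \<Rightarrow> ennreal"
  assumes "\<And>c. convex {x. c < f x}"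
  shows "(\<integral>\<^sup>+ z. difference_function (-\<infinity>) f z \<partial>lebesgue)
      \<le> ennreal ((1/2) ^ CARD('n) * real ((2 * CARD('n)) choose CARD('n))) * (\<integral>\<^sup>+ x. f x \<partial>lebesgue)"
    (is "_ \<le> ennreal ?k * _")
proof -
  let ?g = "difference_function (-\<infinity>) f"
  interpret sigma_finite_measure "lebesgue :: (real ^ 'n) measure"
    by (rule sigma_finite_completion) (rule lborel.sigma_finite_measure_axioms)
  have g: "?g \<in> borel_measurable lebesgue"
    by (rule borel_measurable_difference_function_minfty[OF assms])
  have f [measurable]: "f \<in> borel_measurable lebesgue"
    using assms by (rule borel_measurable_lebesgue_quasiconcave)
  have level: "emeasure lebesgue {z. c < ?g z} \<le> ennreal ?k * emeasure lebesgue {x. c < f x}" for c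
  proof -
    have "emeasure lebesgue {z. c < ?g z}
        = ennreal ((1/2) ^ CARD('n)) * emeasure lebesgue (difference_body {x. c < f x})"
      unfolding superlevel_difference_function by (subst emeasure_lebesgue_affine) simp
    also have "\<dots> \<le> ennreal ((1/2) ^ CARD('n)) *
        (ennreal (real ((2 * CARD('n)) choose CARD('n))) * emeasure lebesgue {x. c < f x})"
      using rogers_shephard[OF assms] by (intro mult_left_mono) simp_all
    finally show ?thesis by (simp add: ennreal_mult mult.assoc)
  qed
  have "(\<integral>\<^sup>+ z. ?g z \<partial>lebesgue)
      = (\<integral>\<^sup>+ t. indicator {0..} t * emeasure lebesgue {z. ennreal t < ?g z} \<partial>lborel)"
    using nn_integral_layer_cake[OF g] by simp
  also have "\<dots> \<le> (\<integral>\<^sup>+ t. ennreal ?k * (indicator {0..} t * emeasure lebesgue {x. ennreal t < f x}) \<partial>lborel)"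
    using level by (intro nn_integral_mono) (auto simp: indicator_def)
  also have "\<dots> = ennreal ?k * (\<integral>\<^sup>+ t. indicator {0..} t * emeasure lebesgue {x. ennreal t < f x} \<partial>lborel)"
  proof (rule nn_integral_cmult)
    have "(\<lambda>t. emeasure lebesgue {x \<in> space lebesgue. ennreal t < f x}) \<in> borel_measurable lborel"
      by measurable
    then show "(\<lambda>t. indicator {0..} t * emeasure lebesgue {x. ennreal t < f x}) \<in> borel_measurable lborel"
      by simp
  qed
  also have "\<dots> = ennreal ?k * (\<integral>\<^sup>+ x. f x \<partial>lebesgue)"
    using nn_integral_layer_cake[OF f] by simp
  finally show ?thesis .
qed

theorem theorem4p5:
  fixes \<alpha> :: ereal
  assumes "\<alpha> < 0"
  shows "difference_constant TYPE('n::finite) \<alpha> \<le>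
           ennreal (1 / 2 powr (real CARD('n) + real_of_ereal (1 / \<alpha>))
             * real ((2 * CARD('n)) choose CARD('n)))"
  unfolding difference_constant_def
proof (safe intro!: Sup_least)
  fix f :: "real ^ 'n \<Rightarrow> ennreal"
  let ?I = "\<integral>\<^sup>+ x. f x \<partial>lebesgue"
  let ?c = "(1/2) powr real_of_ereal (1 / \<alpha>) :: real"
  let ?k = "(1/2) ^ CARD('n) * real ((2 * CARD('n)) choose CARD('n))"
  assume conc: "alpha_concave \<alpha> f" and I: "0 < ?I" "?I < \<infinity>"
  have conv: "convex {x. c < f x}" for c
    by (rule convex_superlevel[OF assms conc])
  \<comment> \<open>The pointwise comparison passes to integrals by monotonicity, and the constant
    is then pulled out of the integral of the order -\<infinity> function, whose measurability is
    established.\<close>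
  have "difference_function \<alpha> f z \<le> ennreal ?c * difference_function (-\<infinity>) f z" for z
    unfolding difference_function_def[of \<alpha>]
  proof (safe intro!: Sup_least)
    fix x y :: "real ^ 'n"
    have "min (f x) (f (- y)) \<le> difference_function (-\<infinity>) f ((1/2) *\<^sub>R (x + y))"
      unfolding difference_function_def by (intro Sup_upper) (auto simp: alpha_mean_def)
    then show "alpha_mean \<alpha> (f x) (f (- y)) (1/2)
        \<le> ennreal ?c * difference_function (-\<infinity>) f ((1/2) *\<^sub>R (x + y))"
      using alpha_mean_half_le[OF assms] by (meson mult_left_mono order_trans zero_le)
  qed
  then have "(\<integral>\<^sup>+ z. difference_function \<alpha> f z \<partial>lebesgue)
      \<le> (\<integral>\<^sup>+ z. ennreal ?c * difference_function (-\<infinity>) f z \<partial>lebesgue)"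
    by (rule nn_integral_mono)
  also have "\<dots> = ennreal ?c * (\<integral>\<^sup>+ z. difference_function (-\<infinity>) f z \<partial>lebesgue)"
    by (rule nn_integral_cmult[OF borel_measurable_difference_function_minfty[OF conv]])
  also have "\<dots> \<le> ennreal ?c * (ennreal ?k * ?I)"
    by (intro mult_left_mono nn_integral_difference_function_minfty conv) simp
  also have "\<dots> = ennreal (?c * ?k) * ?I"
    by (simp add: ennreal_mult mult.assoc)
  also have "?c * ?k = 1 / 2 powr (real CARD('n) + real_of_ereal (1 / \<alpha>)) * real ((2 * CARD('n)) choose CARD('n))"
    by (simp add: powr_add powr_realpow powr_divide power_one_over)
  finally show "(\<integral>\<^sup>+ z. difference_function \<alpha> f z \<partial>lebesgue) / ?I
      \<le> ennreal (1 / 2 powr (real CARD('n) + real_of_ereal (1 / \<alpha>)) * real ((2 * CARD('n)) choose CARD('n)))"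
    using I(1) by (intro divide_le_posI_ennreal) (simp_all add: mult.commute)
qed

end
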